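(* Let $\mathbf{a} \in \mathsf{RAsc}_n$ and $M=f_{\mathsf{AM}}(\mathbf{a})$ with $\dim(M)=d$ and entries $m_{ij}$. Then \[ \mathbf{a} = (0^{m_{11}},1^{m_{22}},0^{m_{12}}, 2^{m_{33}},1^{m_{23}},0^{m_{13}},\ldots,(d-1)^{m_{dd}},(d-2)^{m_{d-1\,d}},\ldots,0^{m_{1d}}), \] and the dual ascent sequence $\mathbf{a}^*$ according to $f_{\mathsf{PA}}$ is given by \[ \mathbf{a}^*= (0^{m_{dd}},1^{m_{d-1\, d-1}},0^{m_{d-1\, d}}, 2^{m_{d-2\, d-2}},1^{m_{d-2\,d-1}},0^{m_{d-2\, d}},\ldots,(d-1)^{m_{11}},(d-2)^{m_{12}},\ldots,0^{m_{1d}}). \]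
   Context: Ascent sequences: $a_1=0$, $a_i\le\mathsf{asc}(a_1,\ldots,a_{i-1})+1$. $\mathsf{RAsc}_n$: ascent sequences with $a_k\in[0,a_{k-1}]\cup\{1+\mathsf{asc}(a_1,\ldots,a_{k-1})\}$ for $k>1$. $i^j$ denotes $j$ copies of $i$. $f_{\mathsf{AM}}$: with $\mathsf{mindex}(M)$ the lowest row index whose rightmost entry is non-zero, $M^{(1)}=(1)$; if $a_{k+1}<\mathsf{mindex}(M^{(k)})$ add $1$ at $(a_{k+1}+1,\dim M^{(k)})$; if $a_{k+1}=\dim M^{(k)}$ append a zero row and column with diagonal entry $1$ (for sequences in $\mathsf{RAsc}_n$ no other case arises); $f_{\mathsf{AM}}(\mathbf{a})=M^{(n)}$. $f_{\mathsf{AP}}$ maps ascent sequences to (2+2)-free posets: in such a poset $P$, strict downsets form a chain $\emptyset=D_0\subsetneq\cdots\subsetneq D_{\ell(P)}$, level $L_i$ is the set of elements with strict downset $D_i$, and $\ell^\star(P)$ is the minimum index of a level containing a maximal element. Start with a one-element poset; given $P^{(k)}$: (AP1) if $a_{k+1}\le\ell^\star(P^{(k)})$, add a new maximal element covering the same elements as the elements of $L_{a_{k+1}}$; (AP2) if $a_{k+1}=1+\ell(P^{(k)})$, add a new element covering all maximal elements; (AP3) if $\ell^\star(P^{(k)})<a_{k+1}\le\ell(P^{(k)})$, add a new element covering the same elements as those in $L_{a_{k+1}}$, and add relations $x\prec y$ for every maximal $x$ at level $<a_{k+1}$ and every old $y$ at level $\ge a_{k+1}$. $f_{\mathsf{PA}}$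 is the inverse of $f_{\mathsf{AP}}$. The dual of $\mathbf{a}$ according to $f_{\mathsf{PA}}$ is $\mathbf{a}^*=f_{\mathsf{PA}}(P^* )$ where $P=f_{\mathsf{AP}}(\mathbf{a})$ and $P^*$ is $P$ with all order relations reversed. *)

theory Defs
  imports Main "Jordan_Normal_Form.Matrix"
begin

text \<open>Sequences \<open>(a\<^sub>1, \<dots>, a\<^sub>n)\<close> are lists of naturals, so \<open>a\<^sub>k\<close> is \<open>a ! (k - 1)\<close>
  and \<open>(a\<^sub>1, \<dots>, a\<^sub>k)\<close> is \<open>take k a\<close>.\<close>

definition asc :: "nat list \<Rightarrow> nat" where
  "asc a = card {i. Suc i < length a \<and> a ! i < a ! Suc i}"

text \<open>The condition \<open>a\<^sub>1 = 0\<close> presupposes a non-empty sequence.\<close>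

definition ascent_seq :: "nat list \<Rightarrow> bool" where
  "ascent_seq a \<longleftrightarrow> a \<noteq> [] \<and> a ! 0 = 0 \<and>
     (\<forall>k. 0 < k \<and> k < length a \<longrightarrow> a ! k \<le> asc (take k a) + 1)"

definition RAsc :: "nat \<Rightarrow> nat list set" where
  "RAsc n = {a. length a = n \<and> ascent_seq a \<and>
     (\<forall>k. 0 < k \<and> k < n \<longrightarrow> a ! k \<in> {0..a ! (k - 1)} \<union> {1 + asc (take k a)})}"


text \<open>Library matrices are indexed from 0, but \<open>mindex\<close> counts rows from 1.\<close>

definition mindex :: "nat mat \<Rightarrow> nat" where
  "mindex M = (LEAST i. 1 \<le> i \<and> i \<le> dim_row M \<and> M $$ (i - 1, dim_col M - 1) \<noteq> 0)"

text \<open>On \<open>RAsc\<close> one of the first two cases always applies; the map is left unspecified elsewhere.\<close>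

definition AM_step :: "nat mat \<Rightarrow> nat \<Rightarrow> nat mat" where
  "AM_step M x = (let d = dim_row M in
     if x < mindex M then M + mat d d (\<lambda>p. if p = (x, d - 1) then 1 else 0)
     else if x = d then four_block_mat M (0\<^sub>m d 1) (0\<^sub>m 1 d) (1\<^sub>m 1)
     else undefined)"

definition f_AM :: "nat list \<Rightarrow> nat mat" where
  "f_AM a = foldl AM_step (1\<^sub>m 1) (tl a)"


text \<open>A finite poset is given by its carrier and its strict order relation,
  \<open>(x, y) \<in> snd P\<close> meaning \<open>x \<prec> y\<close>.\<close>

type_synonym 'a poset = "'a set \<times> 'a rel"

definition downset :: "'a poset \<Rightarrow> 'a \<Rightarrow> 'a set" where
  "downset P x = {y \<in> fst P. (y, x) \<in> snd P}"

definition downsets :: "'a poset \<Rightarrow> 'a set set" where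
  "downsets P = downset P ` fst P"

text \<open>In a (2+2)-free poset the strict downsets form a chain \<open>D\<^sub>0 \<subset> \<dots> \<subset> D\<^sub>\<ell>\<close>, so \<open>D\<^sub>i\<close> is the
  strict downset with exactly \<open>i\<close> strict downsets properly below it.\<close>

definition level_of :: "'a poset \<Rightarrow> 'a \<Rightarrow> nat" where
  "level_of P x = card {D \<in> downsets P. D \<subset> downset P x}"

definition level :: "'a poset \<Rightarrow> nat \<Rightarrow> 'a set" where
  "level P i = {x \<in> fst P. level_of P x = i}"

definition ell :: "'a poset \<Rightarrow> nat" where
  "ell P = card (downsets P) - 1"

definition maximals :: "'a poset \<Rightarrow> 'a set" where
  "maximals P = {x \<in> fst P. \<forall>y \<in> fst P. (x, y) \<notin> snd P}"

definition ell_star :: "'a poset \<Rightarrow> nat" where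
  "ell_star P = (LEAST i. level P i \<inter> maximals P \<noteq> {})"

definition covers :: "'a poset \<Rightarrow> 'a \<Rightarrow> 'a \<Rightarrow> bool" where
  "covers P x y \<longleftrightarrow> x \<in> fst P \<and> y \<in> fst P \<and> (y, x) \<in> snd P \<and>
     (\<nexists>z. z \<in> fst P \<and> (y, z) \<in> snd P \<and> (z, x) \<in> snd P)"

definition covered_by_level :: "'a poset \<Rightarrow> nat \<Rightarrow> 'a set" where
  "covered_by_level P i = {y. \<exists>x \<in> level P i. covers P x y}"

text \<open>The \<open>k\<close>-th element added to the poset is labelled \<open>k - 1\<close>, so the carrier after \<open>k\<close> steps
  is \<open>{0..<k}\<close> and \<open>card (fst P)\<close> is a fresh label. New relations are closed under transitivity.\<close>

definition AP_step :: "nat poset \<Rightarrow> nat \<Rightarrow> nat poset" where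
  "AP_step P i = (let z = card (fst P); A = insert z (fst P); R = snd P in
     if i \<le> ell_star P then
       (A, (R \<union> covered_by_level P i \<times> {z})\<^sup>+)
     else if i = 1 + ell P then
       (A, (R \<union> maximals P \<times> {z})\<^sup>+)
     else if i \<le> ell P then
       (A, (R \<union> covered_by_level P i \<times> {z}
              \<union> {x \<in> maximals P. level_of P x < i} \<times> {y \<in> fst P. i \<le> level_of P y})\<^sup>+)
     else undefined)"

definition f_AP :: "nat list \<Rightarrow> nat poset" where
  "f_AP a = foldl AP_step ({0}, {}) (tl a)"

definition poset_iso :: "'a poset \<Rightarrow> 'b poset \<Rightarrow> bool" where
  "poset_iso P Q \<longleftrightarrow> (\<exists>f. bij_betw f (fst P) (fst Q) \<and>
     (\<forall>x \<in> fst P. \<forall>y \<in> fst P. (x, y) \<in> snd P \<longleftrightarrow> (f x, f y) \<in> snd Q))"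

text \<open>Posets are unlabelled, that is, considered up to isomorphism: \<open>f_PA\<close> is the inverse of the
  map sending an ascent sequence to the isomorphism class of its poset.\<close>

definition f_PA :: "'a poset \<Rightarrow> nat list" where
  "f_PA P = (THE a. ascent_seq a \<and> poset_iso (f_AP a) P)"

definition dual_poset :: "'a poset \<Rightarrow> 'a poset" where
  "dual_poset P = (fst P, (snd P)\<inverse>)"

definition dual_asc :: "nat list \<Rightarrow> nat list" where
  "dual_asc a = f_PA (dual_poset (f_AP a))"

end

theory Submission
  imports Defs "HOL-Combinatorics.Permutations"
begin

text \<open>
  A (2+2)-free poset is an interval order: its elements carry intervals \<open>(r, c)\<close> with
  \<open>r \<le> c\<close>, and \<open>p \<prec> q\<close> holds iff the right endpoint of \<open>p\<close> is smaller than the left endpoint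
  of \<open>q\<close>. If every value in \<open>{0..\<ell>}\<close> is both a left and a right endpoint, then \<open>r\<close> is the level
  of the element and \<open>\<ell> - c\<close> its level in the dual poset. So the intervals are unique, their
  multiset determines the poset up to isomorphism, and dualizing is the reflection
  \<open>(r, c) \<mapsto> (\<ell> - c, \<ell> - r)\<close>. Each of (AP1), (AP2), (AP3) acts on the intervals by an explicit
  rule that can be undone from the multiset alone, which makes \<open>f_AP\<close> injective up to
  isomorphism, so that \<open>f_PA\<close> is well defined on its image.

  On \<open>RAsc\<close> only (AP1) and (AP2) occur. They append intervals without changing the old ones, and
  \<open>f_AM\<close> counts how often each interval occurs. The left endpoints, in order of insertion, are
  the entries of the sequence, and the intervals are inserted by increasing \<open>c\<close> and, within a
  column, by decreasing \<open>r\<close>; this is the first formula. Conversely every multiset of intervals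
  containing the diagonal \<open>(i, i)\<close>, \<open>i \<le> \<ell>\<close>, arises in this way. This property of the multiset is
  invariant under reflection, which gives the second formula.
\<close>

section \<open>Interval representations of posets\<close>

definition interval_rep :: "'a poset \<Rightarrow> nat \<Rightarrow> ('a \<Rightarrow> nat \<times> nat) \<Rightarrow> bool" where
  "interval_rep P e v \<longleftrightarrow> finite (fst P) \<and>
     snd P = {(p, q). p \<in> fst P \<and> q \<in> fst P \<and> snd (v p) < fst (v q)} \<and>
     (\<forall>p \<in> fst P. fst (v p) \<le> snd (v p)) \<and>
     (\<lambda>p. fst (v p)) ` fst P = {..e} \<and> (\<lambda>p. snd (v p)) ` fst P = {..e}"

context
  fixes P :: "'a poset" and e :: nat and v :: "'a \<Rightarrow> nat \<times> nat"
  assumes rep: "interval_rep P e v"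
begin

lemma rep_finite: "finite (fst P)"
  and rep_rel: "snd P = {(p, q). p \<in> fst P \<and> q \<in> fst P \<and> snd (v p) < fst (v q)}"
  and rep_valid: "p \<in> fst P \<Longrightarrow> fst (v p) \<le> snd (v p)"
  and rep_fst: "(\<lambda>p. fst (v p)) ` fst P = {..e}"
  and rep_snd: "(\<lambda>p. snd (v p)) ` fst P = {..e}"
  using rep unfolding interval_rep_def by blast+

lemma rep_fst_le: "p \<in> fst P \<Longrightarrow> fst (v p) \<le> e"
  using rep_fst by auto

lemma rep_snd_le: "p \<in> fst P \<Longrightarrow> snd (v p) \<le> e"
  using rep_snd by auto

lemma rep_fst_ex: "i \<le> e \<Longrightarrow> \<exists>p \<in> fst P. fst (v p) = i"
  using rep_fst by (metis (no_types, lifting) atMost_iff imageE)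

lemma rep_snd_ex: "i \<le> e \<Longrightarrow> \<exists>p \<in> fst P. snd (v p) = i"
  using rep_snd by (metis (no_types, lifting) atMost_iff imageE)

text \<open>Candidate for the \<open>i\<close>-th strict downset: the downset of an element depends
  only on its left endpoint, and \<open>below\<close> expresses it as a function of that
  endpoint.\<close>

private definition below :: "nat \<Rightarrow> 'a set" where
  "below i = {p \<in> fst P. snd (v p) < i}"

text \<open>Strictness uses that every value is a right endpoint: an element ending exactly at
  \<open>i\<close> separates the two sets.\<close>

private lemma below_psubset_iff: 
  assumes "i \<le> e" "j \<le> e"
  shows "below i \<subset> below j \<longleftrightarrow> i < j"
proof
  assume "below i \<subset> below j"
  then show "i < j"
    by (auto simp: below_def)
next
  assume "i < j"
  then obtain p where "p \<in> fst P" "snd (v p) = i" using rep_snd_ex assms by blast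
  then have "p \<in> below j" "p \<notin> below i" using \<open>i < j\<close> by (auto simp: below_def)
  moreover have "below i \<subseteq> below j" using \<open>i < j\<close> by (auto simp: below_def)
  ultimately show "below i \<subset> below j" by blast
qed

private lemma inj_below: "inj_on below {..e}"
proof (rule inj_onI)
  fix i j assume "i \<in> {..e}" "j \<in> {..e}" "below i = below j"
  then show "i = j" using below_psubset_iff[of i j] below_psubset_iff[of j i] by force
qed

private lemma downset_below: "q \<in> fst P \<Longrightarrow> downset P q = below (fst (v q))"
  by (auto simp: downset_def below_def rep_rel)

private lemma downsets_below: "downsets P = below ` {..e}"
proof -
  have "downsets P = (\<lambda>q. below (fst (v q))) ` fst P"
    unfolding downsets_def by (intro image_cong refl) (simp add: downset_below)
  also have "\<dots> = below ` (\<lambda>q. fst (v q)) ` fst P" by (simp add: image_image)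
  finally show ?thesis by (simp add: rep_fst)
qed

lemma rep_ell: "ell P = e"
  by (simp add: ell_def downsets_below card_image[OF inj_below])

text \<open>The downsets form the strict chain \<open>below 0\<close>, ..., \<open>below e\<close>,
  so exactly \<open>fst (v q)\<close> of them lie properly inside
  \<open>below (fst (v q))\<close>.\<close>

lemma rep_level_of: 
  assumes "q \<in> fst P"
  shows "level_of P q = fst (v q)"
proof -
  have le: "fst (v q) \<le> e" using assms rep_fst_le by blast
  have "{D \<in> downsets P. D \<subset> downset P q} = below ` {i \<in> {..e}. below i \<subset> below (fst (v q))}"
    unfolding downsets_below downset_below[OF assms] by blast
  also have "{i \<in> {..e}. below i \<subset> below (fst (v q))} = {..<fst (v q)}"
  proof (rule Set.set_eqI)
    fix i
    show "i \<in> {i \<in> {..e}. below i \<subset> below (fst (v q))} \<longleftrightarrow> i \<in> {..<fst (v q)}"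
      using le below_psubset_iff[of i "fst (v q)"] by (cases "i \<le> e") auto
  qed
  finally have "{D \<in> downsets P. D \<subset> downset P q} = below ` {..<fst (v q)}" .
  moreover have "inj_on below {..<fst (v q)}"
    by (rule inj_on_subset[OF inj_below]) (use le in auto)
  ultimately show ?thesis by (simp add: level_of_def card_image)
qed

lemma rep_level: "level P i = {p \<in> fst P. fst (v p) = i}"
  by (auto simp: level_def rep_level_of)

lemma rep_maximals: "maximals P = {p \<in> fst P. snd (v p) = e}"
proof -
  \<comment> \<open>Since \<open>q\<close> starts at \<open>e\<close>, every element that ends
    before \<open>e\<close> lies below it and is not maximal.\<close>
  obtain q where q: "q \<in> fst P" "fst (v q) = e" using rep_fst_ex by blast
  have "snd (v p) = e" if "p \<in> fst P" "\<forall>y \<in> fst P. (p, y) \<notin> snd P" for p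
    using that q rep_snd_le[of p] by (force simp: rep_rel)
  moreover have "(p, y) \<notin> snd P" if "snd (v p) = e" "y \<in> fst P" for p y
    using that rep_fst_le[of y] by (auto simp: rep_rel)
  ultimately show ?thesis by (auto simp: maximals_def)
qed

lemma rep_ell_star: "ell_star P = (LEAST i. \<exists>p \<in> fst P. v p = (i, e))"
  unfolding ell_star_def rep_level rep_maximals
  by (rule arg_cong[where f = Least]) (force simp: prod_eq_iff)

lemma rep_covered_subset: "covered_by_level P i \<subseteq> {p \<in> fst P. snd (v p) < i}"
  by (auto simp: covered_by_level_def covers_def rep_level rep_rel)

text \<open>Among the elements above \<open>p\<close> that lie below level \<open>i\<close>, one with a maximal right
  endpoint is covered by level \<open>i\<close>.\<close>

lemma rep_covered_above:
  assumes p: "p \<in> fst P" "snd (v p) < i" and i: "i \<le> e"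
  shows "p \<in> covered_by_level P i \<or> (\<exists>q \<in> covered_by_level P i. (p, q) \<in> snd P)"
proof -
  obtain x where x: "x \<in> fst P" "fst (v x) = i" using rep_fst_ex i by blast
  let ?S = "{q \<in> fst P. (q = p \<or> (p, q) \<in> snd P) \<and> snd (v q) < i}"
  have "finite ?S" "p \<in> ?S" using rep_finite p by auto
  then have "Max ((\<lambda>q. snd (v q)) ` ?S) \<in> (\<lambda>q. snd (v q)) ` ?S" by (intro Max_in) auto
  then obtain q where q: "q \<in> ?S" "Max ((\<lambda>q. snd (v q)) ` ?S) = snd (v q)" by blast
  have q_max: "snd (v q') \<le> snd (v q)" if "q' \<in> ?S" for q'
    unfolding q(2)[symmetric] using \<open>finite ?S\<close> that by (intro Max_ge) auto
  have "\<not> (\<exists>z \<in> fst P. (q, z) \<in> snd P \<and> (z, x) \<in> snd P)"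
  proof
    assume "\<exists>z \<in> fst P. (q, z) \<in> snd P \<and> (z, x) \<in> snd P"
    then obtain z where z: "z \<in> fst P" "(q, z) \<in> snd P" "(z, x) \<in> snd P" by blast
    then have "snd (v q) < snd (v z)" "z \<in> ?S" 
      using q(1) x rep_valid[of z] rep_valid[of q] by (auto simp: rep_rel)
    with q_max[of z] show False by simp
  qed
  then have "covers P x q" using q(1) x by (auto simp: covers_def rep_rel)
  then have "q \<in> covered_by_level P i" using x by (auto simp: covered_by_level_def rep_level)
  then show ?thesis using q(1) by auto
qed

text \<open>All endpoints are at most \<open>e\<close>, so the truncated subtraction is exact and
  reverses the comparison of endpoints.\<close>

lemma rep_dual: "interval_rep (dual_poset P) e (\<lambda>p. (e - snd (v p), e - fst (v p)))"
proof -
  have flip: "(\<lambda>i. e - i) ` {..e} = {..e}"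
  proof
    show "{..e} \<subseteq> (\<lambda>i. e - i) ` {..e}"
    proof
      fix i assume "i \<in> {..e}"
      then show "i \<in> (\<lambda>i. e - i) ` {..e}" by (intro image_eqI[where x = "e - i"]) auto
    qed
  qed auto
  have "(\<lambda>p. e - snd (v p)) ` fst P = (\<lambda>i. e - i) ` (\<lambda>p. snd (v p)) ` fst P"
       "(\<lambda>p. e - fst (v p)) ` fst P = (\<lambda>i. e - i) ` (\<lambda>p. fst (v p)) ` fst P"
    by (simp_all add: image_image)
  then have im: "(\<lambda>p. e - snd (v p)) ` fst P = {..e}" "(\<lambda>p. e - fst (v p)) ` fst P = {..e}"
    by (simp_all only: rep_fst rep_snd flip)
  have rel: "p \<in> fst P \<Longrightarrow> q \<in> fst P \<Longrightarrow> e - fst (v p) < e - snd (v q) \<longleftrightarrow> snd (v q) < fst (v p)" for p q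
    using rep_fst_le[of p] rep_snd_le[of q] by linarith
  have "snd (dual_poset P) = {(p, q). p \<in> fst P \<and> q \<in> fst P \<and> snd (v q) < fst (v p)}"
    by (auto simp: dual_poset_def rep_rel)
  then show ?thesis
    using rep_finite rep_valid im rel by (auto simp: interval_rep_def dual_poset_def diff_le_mono2)
qed

end

section \<open>Uniqueness of the intervals and isomorphism of posets\<close>

lemma interval_rep_unique:
  assumes "interval_rep P e v" "interval_rep P e' v'"
  shows "e = e'" "\<And>p. p \<in> fst P \<Longrightarrow> v p = v' p"
proof -
  show e: "e = e'" using rep_ell[OF assms(1)] rep_ell[OF assms(2)] by simp
  fix p assume p: "p \<in> fst P"
  then have p': "p \<in> fst (dual_poset P)" by (simp add: dual_poset_def)
  have "fst (v p) = fst (v' p)" using rep_level_of[OF assms(1) p] rep_level_of[OF assms(2) p] by simp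
  moreover have "e - snd (v p) = e' - snd (v' p)"
    using rep_level_of[OF rep_dual[OF assms(1)] p'] rep_level_of[OF rep_dual[OF assms(2)] p'] by simp
  ultimately show "v p = v' p"
    using rep_snd_le[OF assms(1) p] rep_snd_le[OF assms(2) p] e by (simp add: prod_eq_iff)
qed

text \<open>Pulling \<open>v'\<close> back along the isomorphism gives a second representation of
  \<open>P\<close>, which must agree with \<open>v\<close>.\<close>

lemma interval_rep_iso:
  assumes rep: "interval_rep P e v" "interval_rep Q e' v'" and iso: "poset_iso P Q"
  shows "e = e'" "image_mset v (mset_set (fst P)) = image_mset v' (mset_set (fst Q))"
proof -
  obtain f where f: "bij_betw f (fst P) (fst Q)"
    "\<forall>x \<in> fst P. \<forall>y \<in> fst P. (x, y) \<in> snd P \<longleftrightarrow> (f x, f y) \<in> snd Q"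
    using iso unfolding poset_iso_def by blast
  then have fim: "f ` fst P = fst Q" by (simp add: bij_betw_def)
  have rel: "snd P = {(p, q). p \<in> fst P \<and> q \<in> fst P \<and> snd (v' (f p)) < fst (v' (f q))}"
  proof -
    have "(p, q) \<in> snd P \<longleftrightarrow> snd (v' (f p)) < fst (v' (f q))" if "p \<in> fst P" "q \<in> fst P" for p q
    proof -
      have "f p \<in> fst Q" "f q \<in> fst Q" using that fim by auto
      then show ?thesis using f(2) that unfolding rep_rel[OF rep(2)] by auto
    qed
    moreover have "snd P \<subseteq> fst P \<times> fst P" using rep_rel[OF rep(1)] by auto
    ultimately show ?thesis by auto
  qed
  have "(\<lambda>p. fst (v' (f p))) ` fst P = {..e'}" "(\<lambda>p. snd (v' (f p))) ` fst P = {..e'}"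
    using rep_fst[OF rep(2)] rep_snd[OF rep(2)] unfolding fim[symmetric] by (simp_all add: image_image)
  then have rep': "interval_rep P e' (\<lambda>p. v' (f p))"
    using rel rep_finite[OF rep(1)] rep_valid[OF rep(2)] fim unfolding interval_rep_def by blast
  show "e = e'" using interval_rep_unique(1)[OF rep(1) rep'] .
  have "image_mset v (mset_set (fst P)) = image_mset (\<lambda>p. v' (f p)) (mset_set (fst P))"
    using interval_rep_unique(2)[OF rep(1) rep'] rep_finite[OF rep(1)] by (intro image_mset_cong) auto
  also have "\<dots> = image_mset v' (image_mset f (mset_set (fst P)))"
    by (simp add: image_mset.compositionality o_def)
  also have "image_mset f (mset_set (fst P)) = mset_set (fst Q)"
    using image_mset_mset_set[of f "fst P"] f(1) by (simp add: bij_betw_def)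
  finally show "image_mset v (mset_set (fst P)) = image_mset v' (mset_set (fst Q))" .
qed

text \<open>Equal multisets yield a permutation of the common carrier that matches intervals, and
  the intervals determine the order.\<close>

lemma poset_iso_if_mset_eq:
  assumes rep: "interval_rep P e v" "interval_rep Q e' v'" and car: "fst P = fst Q"
    and eq: "image_mset v (mset_set (fst P)) = image_mset v' (mset_set (fst P))"
  shows "poset_iso P Q"
proof -
  obtain f where f: "f permutes fst P" "\<forall>x \<in> fst P. v x = v' (f x)"
    using image_mset_eq_implies_permutes[OF rep_finite[OF rep(1)] eq] by blast
  have "bij_betw f (fst P) (fst Q)" using permutes_imp_bij[OF f(1)] car by simp
  moreover have "(x, y) \<in> snd P \<longleftrightarrow> (f x, f y) \<in> snd Q" if "x \<in> fst P" "y \<in> fst P" for x y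
    using that f permutes_in_image[OF f(1)] unfolding rep_rel[OF rep(1)] rep_rel[OF rep(2)]
    by (auto simp: car)
  ultimately show ?thesis unfolding poset_iso_def by blast
qed


section \<open>Adding an element to a represented poset\<close>

lemma trans_interval_rel:
  assumes "\<And>p. p \<in> A \<Longrightarrow> fst (v p) \<le> snd (v p)"
  shows "trans {(p, q). p \<in> A \<and> q \<in> A \<and> snd (v p) < (fst (v q) :: nat)}"
  unfolding trans_def using assms by fastforce

text \<open>In the (AP) steps, \<open>G\<close> consists of the generating relations and
  \<open>R\<close> is the interval order that their closure should equal.\<close>

lemma trancl_eqI:
  assumes "G \<subseteq> R" "trans R" "R \<subseteq> G\<^sup>+"
  shows "G\<^sup>+ = R"
  using assms trancl_mono[of _ G R] trancl_id[of R] by blast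

lemma rep_ell_star_witness:
  assumes "interval_rep P e v"
  shows "\<exists>p \<in> fst P. v p = (ell_star P, e)"
proof -
  obtain p where "p \<in> fst P" "snd (v p) = e" using rep_snd_ex[OF assms] by blast
  then have "\<exists>q \<in> fst P. v q = (fst (v p), e)" by (metis prod.collapse)
  then show ?thesis unfolding rep_ell_star[OF assms]
    by (rule LeastI[of "\<lambda>i. \<exists>q \<in> fst P. v q = (i, e)"])
qed

lemma rep_ell_star_le:
  assumes "interval_rep P e v"
  shows "ell_star P \<le> e"
  using rep_ell_star_witness[OF assms] rep_fst_le[OF assms] by fastforce

lemma AP_step_rep_weak:
  assumes rep: "interval_rep P e v"
    and x: "x \<le> ell_star P"
    and v': "\<And>p. p \<in> fst P \<Longrightarrow> v' p = v p" "v' (card (fst P)) = (x, e)"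
  shows "interval_rep (AP_step P x) e v'"
proof -
  let ?z = "card (fst P)"
  let ?R = "{(p, q). p \<in> insert ?z (fst P) \<and> q \<in> insert ?z (fst P) \<and> snd (v' p) < fst (v' q)}"
  let ?G = "snd P \<union> covered_by_level P x \<times> {?z}"
  have xe: "x \<le> e" using x rep_ell_star_le[OF rep] by simp
  have valid: "\<And>p. p \<in> insert ?z (fst P) \<Longrightarrow> fst (v' p) \<le> snd (v' p)"
    using v' xe rep_valid[OF rep] by auto
  have "?G\<^sup>+ = ?R"
  proof (rule trancl_eqI)
    show "?G \<subseteq> ?R" using rep_covered_subset[OF rep, of x] v' by (auto simp: rep_rel[OF rep])
    show "trans ?R" by (rule trans_interval_rel) (rule valid)
    show "?R \<subseteq> ?G\<^sup>+"
    proof clarify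
      fix p q assume pq: "p \<in> insert ?z (fst P)" "q \<in> insert ?z (fst P)" "snd (v' p) < fst (v' q)"
      \<comment> \<open>The new element ends at \<open>e\<close>, so nothing lies above it.\<close>
      have p: "p \<in> fst P" using pq rep_fst_le[OF rep, of q] v' xe by fastforce
      show "(p, q) \<in> ?G\<^sup>+"
      proof (cases "q = ?z")
        case False
        then have "(p, q) \<in> snd P" using pq p v' by (auto simp: rep_rel[OF rep])
        then show ?thesis by blast
      next
        case True
        then have less: "snd (v p) < x" using pq p v' by simp
        show ?thesis
          \<comment> \<open>Only the elements covered by level \<open>x\<close> are related to the
            new element directly; any other element ending before \<open>x\<close> lies below one of
            them.\<close>
          using rep_covered_above[OF rep p less xe]
            True by (blast intro: trancl_into_trancl)
      qed
    qed
  qed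
  then have "AP_step P x = (insert ?z (fst P), ?R)" using x by (simp add: AP_step_def Let_def)
  moreover have "(\<lambda>p. fst (v' p)) ` fst P = {..e}" "(\<lambda>p. snd (v' p)) ` fst P = {..e}"
    using rep_fst[OF rep] rep_snd[OF rep] v'(1) by (simp_all cong: image_cong_simp)
  ultimately show ?thesis
    using valid xe v'(2) rep_finite[OF rep] by (auto simp: interval_rep_def)
qed

lemma AP_step_rep_top:
  assumes rep: "interval_rep P e v"
    and v': "\<And>p. p \<in> fst P \<Longrightarrow> v' p = v p" "v' (card (fst P)) = (Suc e, Suc e)"
  shows "interval_rep (AP_step P (Suc e)) (Suc e) v'"
proof -
  let ?z = "card (fst P)"
  let ?R = "{(p, q). p \<in> insert ?z (fst P) \<and> q \<in> insert ?z (fst P) \<and> snd (v' p) < fst (v' q)}"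
  let ?G = "snd P \<union> maximals P \<times> {?z}"
  have valid: "\<And>p. p \<in> insert ?z (fst P) \<Longrightarrow> fst (v' p) \<le> snd (v' p)"
    using v' rep_valid[OF rep] by auto
  \<comment> \<open>An element starting at \<open>e\<close> is maximal and lies above every
    non-maximal element, so it links all of these to the new element.\<close>
  obtain t where t: "t \<in> fst P" "fst (v t) = e" using rep_fst_ex[OF rep] by blast
  then have tmax: "t \<in> maximals P"
    using rep_valid[OF rep, of t] rep_snd_le[OF rep, of t] by (auto simp: rep_maximals[OF rep])
  have "?G\<^sup>+ = ?R"
  proof (rule trancl_eqI)
    show "?G \<subseteq> ?R" using v' by (auto simp: rep_rel[OF rep] rep_maximals[OF rep])
    show "trans ?R" by (rule trans_interval_rel) (rule valid)
    show "?R \<subseteq> ?G\<^sup>+"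
    proof clarify
      fix p q assume pq: "p \<in> insert ?z (fst P)" "q \<in> insert ?z (fst P)" "snd (v' p) < fst (v' q)"
      have p: "p \<in> fst P" using pq rep_fst_le[OF rep, of q] v' by fastforce
      show "(p, q) \<in> ?G\<^sup>+"
      proof (cases "q = ?z")
        case False
        then have "(p, q) \<in> snd P" using pq p v' by (auto simp: rep_rel[OF rep])
        then show ?thesis by blast
      next
        case True
        show ?thesis
        proof (cases "p \<in> maximals P")
          case False
          then have "(p, t) \<in> snd P"
            using p t rep_snd_le[OF rep, of p] by (auto simp: rep_maximals[OF rep] rep_rel[OF rep])
          then show ?thesis using tmax True by (blast intro: trancl_into_trancl)
        qed (use True in blast)
      qed
    qed
  qed
  then have "AP_step P (Suc e) = (insert ?z (fst P), ?R)"
    using rep_ell_star_le[OF rep] by (simp add: AP_step_def Let_def rep_ell[OF rep])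
  moreover have "(\<lambda>p. fst (v' p)) ` fst P = {..e}" "(\<lambda>p. snd (v' p)) ` fst P = {..e}"
    using rep_fst[OF rep] rep_snd[OF rep] v'(1) by (simp_all cong: image_cong_simp)
  ultimately show ?thesis
    using valid v'(2) rep_finite[OF rep] by (auto simp: interval_rep_def atMost_Suc)
qed

text \<open>The effect of (AP3) on the intervals of the old elements: a new row \<open>x\<close> and a new column \<open>x\<close>
  are inserted, and the elements of the last column are divided among column \<open>x\<close>, if they now
  precede the elements of the old level \<open>x\<close>, and the new last column.\<close>

definition bump :: "nat \<Rightarrow> nat \<Rightarrow> nat \<times> nat \<Rightarrow> nat \<times> nat" where
  "bump e x p =
     (if fst p < x then fst p else Suc (fst p),
      if snd p = e then if fst p < x then x else Suc e
      else if snd p < x then snd p else Suc (snd p))"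

text \<open>The second disjunct describes the relations that (AP3) adds between old elements:
  maximal ones at level below \<open>x\<close> against those at level at least
  \<open>x\<close>.\<close>

lemma bump_less_iff:
  assumes "fst a \<le> snd a" "snd a \<le> e" "x \<le> e"
  shows "snd (bump e x a) < fst (bump e x b) \<longleftrightarrow>
    snd a < fst b \<or> snd a = e \<and> fst a < x \<and> x \<le> fst b"
  using assms by (cases a; cases b) (auto simp: bump_def)

lemma AP_step_rep_mid:
  assumes rep: "interval_rep P e v"
    and x: "ell_star P < x" "x \<le> e"
    and v': "\<And>p. p \<in> fst P \<Longrightarrow> v' p = bump e x (v p)" "v' (card (fst P)) = (x, Suc e)"
  shows "interval_rep (AP_step P x) (Suc e) v'"
proof -
  let ?z = "card (fst P)"
  define R where "R = {(p, q). p \<in> insert ?z (fst P) \<and> q \<in> insert ?z (fst P) \<and> snd (v' p) < fst (v' q)}"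
  define E where "E = {y \<in> maximals P. level_of P y < x} \<times> {y \<in> fst P. x \<le> level_of P y}"
  define G where "G = snd P \<union> covered_by_level P x \<times> {?z} \<union> E"
  have valid: "fst (v' p) \<le> snd (v' p)" if "p \<in> insert ?z (fst P)" for p
    using that v' x rep_valid[OF rep, of p] rep_snd_le[OF rep, of p] by (auto simp: bump_def)
  have old: "(p, q) \<in> snd P \<union> E \<longleftrightarrow> snd (v' p) < fst (v' q)" if "p \<in> fst P" "q \<in> fst P" for p q
    using that v'(1) bump_less_iff[of "v p" e x "v q"] x(2)
      rep_valid[OF rep, of p] rep_snd_le[OF rep, of p]
    by (simp add: rep_rel[OF rep] rep_maximals[OF rep] rep_level_of[OF rep] conj_assoc E_def)
  \<comment> \<open>No right endpoint crosses \<open>x\<close>, so the covered elements, which are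
    computed in the old poset, still end before \<open>x\<close>.\<close>
  have new: "snd (v' p) < x \<longleftrightarrow> snd (v p) < x" if "p \<in> fst P" for p
    using that v' x by (auto simp: bump_def)
  have "G\<^sup>+ = R"
  proof (rule trancl_eqI)
    have "snd P \<union> E \<subseteq> fst P \<times> fst P" by (auto simp: rep_rel[OF rep] rep_maximals[OF rep] E_def)
    then have "snd P \<union> E \<subseteq> R" using old unfolding R_def by blast
    moreover have "covered_by_level P x \<times> {?z} \<subseteq> R"
      using rep_covered_subset[OF rep, of x] new v' by (auto simp: R_def)
    ultimately show "G \<subseteq> R" unfolding G_def by blast
    show "trans R" unfolding R_def by (rule trans_interval_rel) (rule valid)
    show "R \<subseteq> G\<^sup>+"
    proof (rule subrelI)
      fix p q assume "(p, q) \<in> R"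
      then have pq: "p \<in> insert ?z (fst P)" "q \<in> insert ?z (fst P)" "snd (v' p) < fst (v' q)"
        by (auto simp: R_def)
      have "fst (v' q) \<le> Suc e" using pq(2) rep_fst_le[OF rep, of q] v' x by (auto simp: bump_def)
      then have p: "p \<in> fst P" using pq v' by fastforce
      show "(p, q) \<in> G\<^sup>+"
      proof (cases "q = ?z")
        case False
        then have "(p, q) \<in> snd P \<union> E" using pq p old by blast
        then show ?thesis unfolding G_def by blast
      next
        case True
        then have less: "snd (v p) < x" using pq p v' new by simp
        show ?thesis
          using rep_covered_above[OF rep p less x(2)]
            True unfolding G_def by (blast intro: trancl_into_trancl)
      qed
    qed
  qed
  then have "AP_step P x = (insert ?z (fst P), R)"
    using x by (simp add: AP_step_def Let_def rep_ell[OF rep] G_def E_def)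
  moreover have "(\<lambda>p. fst (v' p)) ` insert ?z (fst P) = {..Suc e}"
  proof
    show "{..Suc e} \<subseteq> (\<lambda>p. fst (v' p)) ` insert ?z (fst P)"
    proof
      fix i assume i: "i \<in> {..Suc e}"
      consider "i < x" | "i = x" | "x < i" by linarith
      then show "i \<in> (\<lambda>p. fst (v' p)) ` insert ?z (fst P)"
      proof cases
        case 1
        then obtain p where "p \<in> fst P" "fst (v p) = i" using rep_fst_ex[OF rep, of i] x by auto
        then show ?thesis using 1 v' by (intro image_eqI[of _ _ p]) (auto simp: bump_def)
      next
        case 2
        then show ?thesis using v'(2) by (intro image_eqI[of _ _ ?z]) auto
      next
        case 3
        then have "i - 1 \<le> e" using i by simp
        then obtain p where "p \<in> fst P" "fst (v p) = i - 1" using rep_fst_ex[OF rep] by blast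
        then show ?thesis using 3 v' by (intro image_eqI[of _ _ p]) (auto simp: bump_def)
      qed
    qed
  qed (use v' x rep_fst_le[OF rep] in \<open>auto simp: bump_def\<close>)
  moreover have "(\<lambda>p. snd (v' p)) ` insert ?z (fst P) = {..Suc e}"
  proof
    show "{..Suc e} \<subseteq> (\<lambda>p. snd (v' p)) ` insert ?z (fst P)"
    proof
      fix i assume i: "i \<in> {..Suc e}"
      then consider "i < x" | "i = x" | "x < i" "i \<le> e" | "i = Suc e" unfolding atMost_iff by linarith
      then show "i \<in> (\<lambda>p. snd (v' p)) ` insert ?z (fst P)"
      proof cases
        case 1
        then obtain p where "p \<in> fst P" "snd (v p) = i" using rep_snd_ex[OF rep, of i] x by auto
        then show ?thesis using 1 v' x by (intro image_eqI[of _ _ p]) (auto simp: bump_def)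
      next
        case 2
        \<comment> \<open>Column \<open>x\<close> is non-empty because
          \<open>ell_star P < x\<close>: the element of the last column in row
          \<open>ell_star P\<close> is moved into it.\<close>
        obtain p where "p \<in> fst P" "v p = (ell_star P, e)" using rep_ell_star_witness[OF rep] by blast
        then show ?thesis using 2 v' x by (intro image_eqI[of _ _ p]) (auto simp: bump_def)
      next
        case 3
        then have "i - 1 \<le> e" by simp
        then obtain p where "p \<in> fst P" "snd (v p) = i - 1" using rep_snd_ex[OF rep] by blast
        then show ?thesis using 3 v' by (intro image_eqI[of _ _ p]) (auto simp: bump_def)
      next
        case 4
        then show ?thesis using v'(2) by (intro image_eqI[of _ _ ?z]) auto
      qed
    qed
  qed (use v' x rep_snd_le[OF rep] in \<open>auto simp: bump_def\<close>)
  ultimately show ?thesis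
    using valid rep_finite[OF rep] by (simp add: interval_rep_def R_def)
qed


section \<open>Interval lists of ascent sequences\<close>

lemma asc_snoc:
  assumes "a \<noteq> []"
  shows "asc (a @ [x]) = asc a + (if last a < x then 1 else 0)"
proof -
  let ?A = "{i. Suc i < length a \<and> a ! i < a ! Suc i}"
  have "finite ?A" by (rule finite_subset[of _ "{..<length a}"]) auto
  moreover have "length a - 1 \<notin> ?A" by auto
  moreover have "{i. Suc i < length (a @ [x]) \<and> (a @ [x]) ! i < (a @ [x]) ! Suc i} =
      (if last a < x then insert (length a - 1) ?A else ?A)"
  proof (rule Set.set_eqI)
    fix i
    consider "Suc i < length a" | "Suc i = length a" | "length a < Suc i" by linarith
    then show "i \<in> {i. Suc i < length (a @ [x]) \<and> (a @ [x]) ! i < (a @ [x]) ! Suc i} \<longleftrightarrow>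
        i \<in> (if last a < x then insert (length a - 1) ?A else ?A)"
    proof cases
      case 2
      then have "i = length a - 1" by simp
      then show ?thesis using assms by (simp add: nth_append last_conv_nth)
    qed (use assms in \<open>auto simp: nth_append\<close>)
  qed
  ultimately show ?thesis unfolding asc_def by (simp del: length_append)
qed

lemma ascent_seq_snoc:
  assumes "a \<noteq> []"
  shows "ascent_seq (a @ [x]) \<longleftrightarrow> ascent_seq a \<and> x \<le> asc a + 1"
proof -
  have "(\<forall>k. 0 < k \<and> k < Suc (length a) \<longrightarrow> (a @ [x]) ! k \<le> asc (take k (a @ [x])) + 1) \<longleftrightarrow>
    (\<forall>k. 0 < k \<and> k < length a \<longrightarrow> a ! k \<le> asc (take k a) + 1) \<and> x \<le> asc a + 1"
    using assms by (auto simp: less_Suc_eq nth_append)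
  then show ?thesis using assms by (simp add: ascent_seq_def nth_append)
qed

text \<open>The three insertion rules on intervals alone. Position \<open>p\<close> of the list
  holds the interval of the element labelled \<open>p\<close>. The conditions use
  \<open>last b\<close> in place of \<open>ell_star\<close>; \<open>builds_rep\<close> shows that
  the two agree.\<close>

inductive builds :: "nat list \<Rightarrow> nat \<Rightarrow> (nat \<times> nat) list \<Rightarrow> bool" where
  start: "builds [0] 0 [(0, 0)]"
| weak: "builds b e xs \<Longrightarrow> x \<le> last b \<Longrightarrow> builds (b @ [x]) e (xs @ [(x, e)])"
| top: "builds b e xs \<Longrightarrow> builds (b @ [Suc e]) (Suc e) (xs @ [(Suc e, Suc e)])"
| mid: "builds b e xs \<Longrightarrow> last b < x \<Longrightarrow> x \<le> e \<Longrightarrow>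
    builds (b @ [x]) (Suc e) (map (bump e x) xs @ [(x, Suc e)])"

lemma interval_rep_nth_snoc:
  assumes "fst P = {0..<length xs}"
  shows "(xs @ [y]) ! card (fst P) = y"
    "p \<in> fst P \<Longrightarrow> (xs @ [y]) ! p = xs ! p"
  using assms by (auto simp: nth_append)

lemma fst_AP_step:
  assumes "interval_rep P e v" "x \<le> Suc e"
  shows "fst (AP_step P x) = insert (card (fst P)) (fst P)"
  using assms(2) rep_ell[OF assms(1)] by (auto simp: AP_step_def Let_def)

lemma f_AP_snoc: "b \<noteq> [] \<Longrightarrow> f_AP (b @ [x]) = AP_step (f_AP b) x"
  by (simp add: f_AP_def)

lemma ell_star_snoc:
  assumes "interval_rep P e (nth xs)" "fst P = {0..<length xs}" "(x, e) \<in> set xs"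
    "\<And>i. (i, e) \<in> set xs \<Longrightarrow> x \<le> i"
  shows "ell_star P = x"
  unfolding rep_ell_star[OF assms(1)]
proof (rule Least_equality)
  show "\<exists>p \<in> fst P. xs ! p = (x, e)" using assms(2,3) by (auto simp: in_set_conv_nth)
  show "x \<le> i" if "\<exists>p \<in> fst P. xs ! p = (i, e)" for i
    using that assms(2) assms(4)[of i] nth_mem[of _ xs] by fastforce
qed

text \<open>The claims are proved together: \<open>ell_star = last b\<close> selects the right case
  of \<open>AP_step\<close>, and \<open>last b \<le> e\<close> makes (AP2) an ascent, so that
  \<open>e\<close> grows exactly when \<open>asc\<close> does.\<close>

lemma builds_rep:
  assumes "builds b e xs"
  shows "b \<noteq> [] \<and> e = asc b \<and> ascent_seq b \<and> last b \<le> e \<and>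
    fst (f_AP b) = {0..<length xs} \<and> interval_rep (f_AP b) e (nth xs) \<and> ell_star (f_AP b) = last b"
  using assms
proof induction
  case start
  have rep: "interval_rep (f_AP [0]) 0 (nth [(0, 0)])"
    by (auto simp: f_AP_def interval_rep_def)
  moreover have "ell_star (f_AP [0]) = 0" using rep_ell_star_le[OF rep] by simp
  ultimately show ?case by (simp add: f_AP_def asc_def ascent_seq_def)
next
  case (weak b e xs x)
  then have IH: "b \<noteq> []" "e = asc b" "ascent_seq b" "last b \<le> e" "fst (f_AP b) = {0..<length xs}"
    "interval_rep (f_AP b) e (nth xs)" "ell_star (f_AP b) = last b" by auto
  note snoc = interval_rep_nth_snoc[OF IH(5)]
  have rep: "interval_rep (f_AP (b @ [x])) e (nth (xs @ [(x, e)]))"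
    unfolding f_AP_snoc[OF IH(1)]
    by (rule AP_step_rep_weak[OF IH(6)]) (use snoc weak.hyps IH(7) in auto)
  have car: "fst (f_AP (b @ [x])) = {0..<length (xs @ [(x, e)])}"
    using fst_AP_step[OF IH(6), of x] weak.hyps IH(4,5) by (auto simp: f_AP_snoc[OF IH(1)])
  have "last b \<le> i" if "(i, e) \<in> set xs" for i
  proof -
    obtain p where "p \<in> fst (f_AP b)" "xs ! p = (i, e)"
      using \<open>(i, e) \<in> set xs\<close> IH(5) by (auto simp: in_set_conv_nth)
    then show ?thesis unfolding IH(7)[symmetric] rep_ell_star[OF IH(6)] by (intro Least_le) blast
  qed
  then have "ell_star (f_AP (b @ [x])) = x"
    using weak.hyps by (intro ell_star_snoc[OF rep car]) force+
  then show ?case using rep car IH weak.hyps by (simp add: asc_snoc ascent_seq_snoc)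
next
  case (top b e xs)
  then have IH: "b \<noteq> []" "e = asc b" "ascent_seq b" "last b \<le> e" "fst (f_AP b) = {0..<length xs}"
    "interval_rep (f_AP b) e (nth xs)" "ell_star (f_AP b) = last b" by auto
  note snoc = interval_rep_nth_snoc[OF IH(5)]
  have rep: "interval_rep (f_AP (b @ [Suc e])) (Suc e) (nth (xs @ [(Suc e, Suc e)]))"
    unfolding f_AP_snoc[OF IH(1)]
    by (rule AP_step_rep_top[OF IH(6)]) (use snoc in auto)
  have car: "fst (f_AP (b @ [Suc e])) = {0..<length (xs @ [(Suc e, Suc e)])}"
    using fst_AP_step[OF IH(6), of "Suc e"] IH(5) by (auto simp: f_AP_snoc[OF IH(1)])
  have "snd y \<le> e" if "y \<in> set xs" for y
    using that rep_snd_le[OF IH(6)] IH(5) by (auto simp: in_set_conv_nth)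
  then have "ell_star (f_AP (b @ [Suc e])) = Suc e"
    by (intro ell_star_snoc[OF rep car]) force+
  then show ?case using rep car IH by (simp add: asc_snoc ascent_seq_snoc)
next
  case (mid b e xs x)
  then have IH: "b \<noteq> []" "e = asc b" "ascent_seq b" "last b \<le> e" "fst (f_AP b) = {0..<length xs}"
    "interval_rep (f_AP b) e (nth xs)" "ell_star (f_AP b) = last b" by auto
  let ?xs = "map (bump e x) xs @ [(x, Suc e)]"
  have car': "fst (f_AP b) = {0..<length (map (bump e x) xs)}" using IH(5) by simp
  note snoc = interval_rep_nth_snoc[OF car']
  have rep: "interval_rep (f_AP (b @ [x])) (Suc e) (nth ?xs)"
    unfolding f_AP_snoc[OF IH(1)]
    by (rule AP_step_rep_mid[OF IH(6)]) (use snoc mid.hyps IH(5,7) in auto)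
  have car: "fst (f_AP (b @ [x])) = {0..<length ?xs}"
    using fst_AP_step[OF IH(6), of x] mid.hyps IH(5) by (auto simp: f_AP_snoc[OF IH(1)])
  have "snd y \<le> e" if "y \<in> set xs" for y
    using that rep_snd_le[OF IH(6)] IH(5) by (auto simp: in_set_conv_nth)
  \<comment> \<open>Old elements that stay in the last column have been moved to rows greater than
    \<open>x\<close>.\<close>
  then have "ell_star (f_AP (b @ [x])) = x"
    using mid.hyps by (intro ell_star_snoc[OF rep car]) (auto simp: bump_def split: if_splits)
  then show ?case using rep car IH mid.hyps by (simp add: asc_snoc ascent_seq_snoc)
qed

text \<open>The bound \<open>asc b + 1\<close> on the next entry splits into exactly the ranges of
  the three rules.\<close>

lemma builds_exists:
  assumes "ascent_seq b"
  shows "\<exists>xs. builds b (asc b) xs"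
  using assms
proof (induction b rule: rev_induct)
  case Nil
  then show ?case by (simp add: ascent_seq_def)
next
  case (snoc x b)
  show ?case
  proof (cases "b = []")
    case True
    then have "b @ [x] = [0]" using snoc.prems by (simp add: ascent_seq_def)
    then show ?thesis using builds.start by (auto simp: asc_def)
  next
    case False
    then have b: "ascent_seq b" "x \<le> asc b + 1" using snoc.prems ascent_seq_snoc by auto
    then obtain xs where xs: "builds b (asc b) xs" using snoc.IH by blast
    note rep = builds_rep[OF xs]
    consider "x \<le> last b" | "x = Suc (asc b)" | "last b < x" "x \<le> asc b" using b(2) by linarith
    then show ?thesis
    proof cases
      case 1
      then show ?thesis using builds.weak[OF xs 1] by (auto simp: asc_snoc[OF False])
    next
      case 2
      then show ?thesis using builds.top[OF xs] rep by (auto simp: asc_snoc[OF False])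
    next
      case 3
      then show ?thesis using builds.mid[OF xs 3] by (auto simp: asc_snoc[OF False])
    qed
  qed
qed


section \<open>Recovering the sequence from the multiset of intervals\<close>

lemma builds_set:
  assumes "builds b e xs"
  shows "fst ` set xs = {..e}" "snd ` set xs = {..e}" "y \<in> set xs \<Longrightarrow> fst y \<le> snd y"
    "(last b, e) \<in> set xs" "(i, e) \<in> set xs \<Longrightarrow> last b \<le> i"
proof -
  have rep: "interval_rep (f_AP b) e (nth xs)" and car: "fst (f_AP b) = {0..<length xs}"
    and star: "ell_star (f_AP b) = last b"
    using builds_rep[OF assms] by auto
  have nth_set: "set xs = nth xs ` fst (f_AP b)"
    unfolding car by (metis atLeast_upt image_set map_nth atLeast0LessThan)
  show "fst ` set xs = {..e}" "snd ` set xs = {..e}"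
    using rep_fst[OF rep] rep_snd[OF rep] by (simp_all add: nth_set image_image)
  show "fst y \<le> snd y" if "y \<in> set xs" using that rep_valid[OF rep] by (auto simp: nth_set)
  show "(last b, e) \<in> set xs"
    using rep_ell_star_witness[OF rep] unfolding star nth_set by (metis image_eqI)
  show "last b \<le> i" if "(i, e) \<in> set xs"
    using that unfolding star[symmetric] rep_ell_star[OF rep] nth_set
    by (intro Least_le) (metis imageE)
qed

lemma builds_fst_le: "builds b e xs \<Longrightarrow> y \<in> set xs \<Longrightarrow> fst y \<le> e"
  using builds_set(1) by blast

lemma builds_snd_le: "builds b e xs \<Longrightarrow> y \<in> set xs \<Longrightarrow> snd y \<le> e"
  using builds_set(2) by blast

text \<open>Both values are visible in the set of intervals: \<open>e\<close> is the largest
  endpoint, \<open>last b\<close> the smallest row met by column \<open>e\<close>.\<close>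

lemma builds_mset_eq:
  assumes "builds b e xs" "builds b' e' xs'" "mset xs = mset xs'"
  shows "e = e'" "last b = last b'"
proof -
  have set: "set xs = set xs'" using assms(3) mset_eq_setD by blast
  then show e: "e = e'" using builds_set(1)[OF assms(1)] builds_set(1)[OF assms(2)] by simp
  show "last b = last b'"
    using builds_set(4,5)[OF assms(1)] builds_set(4,5)[OF assms(2)] unfolding set e
    by (meson antisym)
qed

text \<open>The image in column \<open>x\<close> consists of elements split off the old last column,
  and column \<open>Suc e\<close> of the remaining ones, so the old column can be read off the new
  one.\<close>

lemma inj_on_bump: "x \<le> e \<Longrightarrow> inj_on (bump e x) {p. snd p \<le> e}"
  by (rule inj_onI) (auto simp: bump_def prod_eq_iff split: if_splits)

lemma image_mset_inj_onD:
  assumes "inj_on f A" "set_mset M \<subseteq> A" "set_mset N \<subseteq> A" "image_mset f M = image_mset f N"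
  shows "M = N"
proof -
  have "image_mset (inv_into A f) (image_mset f K) = K" if "set_mset K \<subseteq> A" for K
    using that assms(1)
    by (simp add: multiset.map_comp) (rule multiset.map_ident_strong, auto)
  then show ?thesis using assms(2-4) by metis
qed

text \<open>The row of the last element added tells (AP1) apart from (AP2) and (AP3): in the first
  case it has at least two elements, in the others it is new.\<close>

lemma row_size_weak:
  assumes "builds b e xs" "x \<le> last b"
  shows "length (filter (\<lambda>p. fst p = x) (xs @ [(x, e)])) \<noteq> 1"
proof -
  have "x \<in> fst ` set xs" using assms builds_rep[OF assms(1)] by (simp add: builds_set(1))
  then have "filter (\<lambda>p. fst p = x) xs \<noteq> []" by (auto simp: filter_empty_conv)
  then show ?thesis by simp
qed

lemma row_size_top:
  assumes "builds b e xs"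
  shows "length (filter (\<lambda>p. fst p = Suc e) (xs @ [(Suc e, Suc e)])) = 1"
  using builds_fst_le[OF assms] by (fastforce simp: filter_empty_conv)

lemma row_size_mid:
  "length (filter (\<lambda>p. fst p = x) (map (bump e x) xs @ [(x, Suc e)])) = 1"
  by (auto simp: filter_empty_conv bump_def)

lemma length_filter_mset_eq:
  assumes "mset xs = mset ys"
  shows "length (filter Q xs) = length (filter Q ys)"
  using assms by (metis mset_filter mset_eq_length)

text \<open>Induction that undoes the last step. The multiset fixes \<open>e\<close> and the last
  entry; a row of size one excludes (AP1); the last entry equals the new \<open>e\<close> after
  (AP2) and is smaller after (AP3). For (AP3) the old multiset is recovered by injectivity of
  \<open>bump\<close>.\<close>

lemma builds_inj:
  assumes "builds b e xs" "builds b' e' xs'" "mset xs = mset xs'"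
  shows "b = b'"
  using assms
proof (induction arbitrary: b' e' xs')
  case start
  note eqm = start(2)
  from start(1) show ?case
  proof cases
    case (weak b1 xs1 x1)
    then show ?thesis using eqm builds_set(4)[OF weak(3)] by auto
  next
    case (top b1 e1 xs1)
    show ?thesis using eqm unfolding top(3) by simp
  next
    case (mid b1 e1 xs1 x1)
    show ?thesis using eqm unfolding mid(3) by simp
  qed simp
next
  case (weak b e xs x)
  note IH = weak.IH and eqm = weak.prems(2) and hyps = weak.hyps
  note eq = builds_mset_eq[OF builds.weak[OF hyps] weak.prems]
  have row: "length (filter (\<lambda>p. fst p = x) xs') \<noteq> 1"
    unfolding length_filter_mset_eq[OF eqm[symmetric]] by (rule row_size_weak[OF hyps])
  from weak.prems(1) show ?case
  proof cases
    case start
    then show ?thesis using eqm builds_set(4)[OF hyps(1)] by auto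
  next
    case (weak b1 xs1 x1)
    have x: "x1 = x" using eq(2) weak(1) by simp
    have "b = b1" by (rule IH[OF weak(3)]) (use eqm eq(1) weak(2) x in simp)
    then show ?thesis using weak(1) x by simp
  next
    case (top b1 e1 xs1)
    have "x = Suc e1" using eq(2) top(1) by simp
    then show ?thesis using row row_size_top[OF top(4)] unfolding top(3) by blast
  next
    case (mid b1 e1 xs1 x1)
    have "x1 = x" using eq(2) mid(1) by simp
    then show ?thesis using row row_size_mid[of x1 e1 xs1] unfolding mid(3) by blast
  qed
next
  case (top b e xs)
  note IH = top.IH and eqm = top.prems(2) and hyps = top.hyps
  note eq = builds_mset_eq[OF builds.top[OF hyps] top.prems]
  have row: "length (filter (\<lambda>p. fst p = Suc e) xs') = 1"
    unfolding length_filter_mset_eq[OF eqm[symmetric]] by (rule row_size_top[OF hyps])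
  from top.prems(1) show ?case
  proof cases
    case start
    then show ?thesis using eq(1) by simp
  next
    case (weak b1 xs1 x1)
    have x: "x1 = Suc e" "e' = Suc e" using eq weak(1) by simp_all
    show ?thesis using row row_size_weak[OF weak(3,4)] unfolding weak(2) x by blast
  next
    case (top b1 e1 xs1)
    have e: "e1 = e" using eq(1) top(2) by simp
    have "b = b1" by (rule IH[OF top(4)]) (use eqm top(3) e in simp)
    then show ?thesis using top(1) e by simp
  next
    case (mid b1 e1 xs1 x1)
    then show ?thesis using eq by simp
  qed
next
  case (mid b e xs x)
  note IH = mid.IH and eqm = mid.prems(2) and hyps = mid.hyps
  note eq = builds_mset_eq[OF builds.mid[OF hyps] mid.prems]
  have row: "length (filter (\<lambda>p. fst p = x) xs') = 1"
    unfolding length_filter_mset_eq[OF eqm[symmetric]] by (rule row_size_mid)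
  from mid.prems(1) show ?case
  proof cases
    case start
    then show ?thesis using eq(1) by simp
  next
    case (weak b1 xs1 x1)
    have "x1 = x" using eq(2) weak(1) by simp
    then show ?thesis using row row_size_weak[OF weak(3,4)] unfolding weak(2) by blast
  next
    case (top b1 e1 xs1)
    then show ?thesis using eq hyps(3) by simp
  next
    case (mid b1 e1 xs1 x1)
    have e: "e1 = e" and x: "x1 = x" using mid(1,2) eq by simp_all
    have "image_mset (bump e x) (mset xs) = image_mset (bump e x) (mset xs1)"
      using eqm unfolding mid(3) e x by simp
    moreover have "set_mset (mset xs) \<subseteq> {p. snd p \<le> e}" "set_mset (mset xs1) \<subseteq> {p. snd p \<le> e}"
      using builds_snd_le[OF hyps(1)] builds_snd_le[OF mid(4)] e by auto
    ultimately have "mset xs = mset xs1"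
      using image_mset_inj_onD[OF inj_on_bump[OF hyps(3)]] by blast
    then have "b = b1" by (rule IH[OF mid(4)])
    then show ?thesis using mid(1) x by simp
  qed
qed

section \<open>Sequences in \<open>RAsc\<close>\<close>

text \<open>The rules of \<open>builds\<close> without (AP3). Rows never move, so the sequence is
  simply \<open>map fst xs\<close> and its last entry \<open>fst (last xs)\<close>.\<close>

inductive reduced :: "nat \<Rightarrow> (nat \<times> nat) list \<Rightarrow> bool" where
  start: "reduced 0 [(0, 0)]"
| weak: "reduced e xs \<Longrightarrow> x \<le> fst (last xs) \<Longrightarrow> reduced e (xs @ [(x, e)])"
| top: "reduced e xs \<Longrightarrow> reduced (Suc e) (xs @ [(Suc e, Suc e)])"

lemma reduced_builds:
  assumes "reduced e xs"
  shows "xs \<noteq> [] \<and> builds (map fst xs) e xs"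
  using assms
proof induction
  case (weak e xs x)
  then show ?case using builds.weak[of "map fst xs" e xs x] by (simp add: last_map)
next
  case (top e xs)
  then show ?case using builds.top[of "map fst xs" e xs] by simp
qed (simp add: builds.start)

lemma reduced_exists:
  assumes "a \<in> RAsc n"
  shows "\<exists>xs. reduced (asc a) xs \<and> map fst xs = a"
  using assms
proof (induction a arbitrary: n rule: rev_induct)
  case Nil
  then show ?case by (simp add: RAsc_def ascent_seq_def)
next
  case (snoc x a)
  show ?case
  proof (cases "a = []")
    case True
    then have "x = 0" using snoc.prems by (simp add: RAsc_def ascent_seq_def)
    then have "reduced (asc (a @ [x])) [(0, 0)] \<and> map fst [(0 :: nat, 0 :: nat)] = a @ [x]"
      using True reduced.start by (simp add: asc_def)
    then show ?thesis by blast
  next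
    case False
    have n: "n = Suc (length a)" and asc: "ascent_seq a"
      and step: "\<And>k. 0 < k \<Longrightarrow> k < n \<Longrightarrow>
        (a @ [x]) ! k \<le> (a @ [x]) ! (k - 1) \<or> (a @ [x]) ! k = 1 + asc (take k (a @ [x]))"
      using snoc.prems ascent_seq_snoc[OF False, of x] by (auto simp: RAsc_def)
    have "a ! k \<le> a ! (k - 1) \<or> a ! k = 1 + asc (take k a)" if "0 < k" "k < length a" for k
      using step[of k] that by (simp add: n nth_append less_imp_diff_less)
    then have "a \<in> RAsc (length a)" using asc by (auto simp: RAsc_def)
    then obtain xs where xs: "reduced (asc a) xs" "map fst xs = a" using snoc.IH by blast
    have "xs \<noteq> []" using xs(2) False by auto
    then have last: "fst (last xs) = last a" using xs(2) by (metis last_map)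
    have "x \<le> last a \<or> x = Suc (asc a)"
      using step[of "length a"] False by (simp add: n nth_append last_conv_nth)
    then show ?thesis
    proof
      assume "x \<le> last a"
      then show ?thesis
        using reduced.weak[OF xs(1), of x] xs(2) last
        by (intro exI[of _ "xs @ [(x, asc a)]"]) (simp add: asc_snoc[OF False])
    next
      assume x: "x = Suc (asc a)"
      \<comment> \<open>Hence the new entry is an ascent, and \<open>asc\<close> grows together with
        \<open>e\<close>.\<close>
      have "last a \<le> asc a"
        using builds_rep[of a "asc a" xs] reduced_builds[OF xs(1)] xs(2) by auto
      then show ?thesis
        using reduced.top[OF xs(1)] xs(2) x
        by (intro exI[of _ "xs @ [(x, x)]"]) (simp add: asc_snoc[OF False])
    qed
  qed
qed

section \<open>The matrix as the table of interval multiplicities\<close>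

text \<open>Here \<open>x\<close> is a row counted from 0 while \<open>mindex\<close> counts from 1,
  hence the \<open>Suc\<close>.\<close>

lemma mindex_eq:
  assumes "0 < d" "x < d" "f x (d - 1) \<noteq> 0" "\<And>i. i < d \<Longrightarrow> f i (d - 1) \<noteq> 0 \<Longrightarrow> x \<le> i"
  shows "mindex (mat d d (\<lambda>(i, j). f i j)) = Suc x"
  unfolding mindex_def
proof (rule Least_equality)
  fix i assume i: "1 \<le> i \<and> i \<le> dim_row (mat d d (\<lambda>(i, j). f i j)) \<and>
    mat d d (\<lambda>(i, j). f i j) $$ (i - 1, dim_col (mat d d (\<lambda>(i, j). f i j)) - 1) \<noteq> 0"
  then have "i - 1 < d" "f (i - 1) (d - 1) \<noteq> 0" using assms(1) by auto
  then have "x \<le> i - 1" by (rule assms(4))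
  then show "Suc x \<le> i" using i by linarith
qed (use assms in auto)

lemma f_AM_snoc: "b \<noteq> [] \<Longrightarrow> f_AM (b @ [x]) = AM_step (f_AM b) x"
  by (simp add: f_AM_def)

text \<open>The last interval lies in the smallest non-zero row of the last column, so the test
  \<open>x < mindex M\<close> becomes \<open>x \<le> fst (last xs)\<close>, the condition of
  (AP1).\<close>

lemma f_AM_reduced:
  assumes "reduced e xs"
  shows "f_AM (map fst xs) = mat (Suc e) (Suc e) (\<lambda>(i, j). count (mset xs) (i, j))"
  using assms
proof induction
  case start
  show ?case by (rule eq_matI) (auto simp: f_AM_def)
next
  case (weak e xs x)
  have b: "builds (map fst xs) e xs" and ne: "xs \<noteq> []" using reduced_builds[OF weak.hyps(1)] by auto
  have min: "mindex (f_AM (map fst xs)) = Suc (fst (last xs))"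
    unfolding weak.IH using builds_set[OF b] builds_rep[OF b] ne
    by (intro mindex_eq) (auto simp: last_map count_eq_zero_iff)
  have "f_AM (map fst (xs @ [(x, e)])) = AM_step (f_AM (map fst xs)) x"
    using ne by (simp add: f_AM_snoc)
  also have "\<dots> = mat (Suc e) (Suc e) (\<lambda>(i, j). count (mset (xs @ [(x, e)])) (i, j))"
    using weak.hyps(2) min by (intro eq_matI) (auto simp: AM_step_def Let_def weak.IH)
  finally show ?case .
next
  case (top e xs)
  have b: "builds (map fst xs) e xs" and ne: "xs \<noteq> []" using reduced_builds[OF top.hyps(1)] by auto
  have min: "mindex (f_AM (map fst xs)) = Suc (fst (last xs))"
    unfolding top.IH using builds_set[OF b] builds_rep[OF b] ne
    by (intro mindex_eq) (auto simp: last_map count_eq_zero_iff)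
  \<comment> \<open>This bounds \<open>mindex\<close> by \<open>Suc e\<close>, so the entry
    \<open>Suc e\<close> falls into the branch that enlarges the matrix.\<close>
  have le: "fst (last xs) \<le> e" using builds_rep[OF b] ne by (simp add: last_map)
  have "(i, j) \<notin> set xs" if "i = Suc e \<or> j = Suc e" for i j
    using that builds_fst_le[OF b] builds_snd_le[OF b] by fastforce
  then have zero: "count (mset xs) (i, j) = 0" if "i = Suc e \<or> j = Suc e" for i j
    using that by (simp add: count_eq_zero_iff)
  have "f_AM (map fst (xs @ [(Suc e, Suc e)])) = AM_step (f_AM (map fst xs)) (Suc e)"
    using ne by (simp add: f_AM_snoc)
  also have "\<dots> = mat (Suc (Suc e)) (Suc (Suc e)) (\<lambda>(i, j). count (mset (xs @ [(Suc e, Suc e)])) (i, j))"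
    using le min zero by (intro eq_matI) (auto simp: AM_step_def Let_def top.IH less_Suc_eq)
  finally show ?case .
qed

section \<open>Reading a matrix column by column\<close>

text \<open>Pairs are kept instead of rows so that the list retains the multiset of intervals; the
  variable height \<open>j\<close> permits induction.\<close>

definition column_list :: "(nat \<Rightarrow> nat \<Rightarrow> nat) \<Rightarrow> nat \<Rightarrow> nat \<Rightarrow> (nat \<times> nat) list" where
  "column_list f k j = concat (map (\<lambda>v. replicate (f v k) (v, k)) (rev [0..<j]))"

definition matrix_list :: "(nat \<Rightarrow> nat \<Rightarrow> nat) \<Rightarrow> nat \<Rightarrow> (nat \<times> nat) list" where
  "matrix_list f d = concat (map (\<lambda>k. column_list f k (Suc k)) [0..<d])"

lemma column_list_0 [simp]: "column_list f k 0 = []"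
  by (simp add: column_list_def)

lemma column_list_Suc: "column_list f k (Suc j) = replicate (f j k) (j, k) @ column_list f k j"
  by (simp add: column_list_def)

lemma matrix_list_Suc: "matrix_list f (Suc d) = matrix_list f d @ column_list f d (Suc d)"
  by (simp add: matrix_list_def)

lemma column_list_cong: "(\<And>v. v < j \<Longrightarrow> f v k = g v k) \<Longrightarrow> column_list f k j = column_list g k j"
  by (induction j) (simp_all add: column_list_Suc)

lemma matrix_list_cong:
  "(\<And>v k. v \<le> k \<Longrightarrow> k < d \<Longrightarrow> f v k = g v k) \<Longrightarrow> matrix_list f d = matrix_list g d"
  by (induction d) (simp_all add: matrix_list_def cong: column_list_cong)

lemma column_list_eq_Nil: "(\<And>v. v < j \<Longrightarrow> f v k = 0) \<Longrightarrow> column_list f k j = []"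
  by (induction j) (simp_all add: column_list_Suc)

text \<open>The rows after \<open>x\<close> in reading order are the smaller ones. They are empty,
  so the extra copy of \<open>(x, k)\<close> comes last.\<close>

lemma column_list_snoc:
  assumes "\<And>v. v < x \<Longrightarrow> f v k = 0" "g x k = Suc (f x k)" "\<And>v. v \<noteq> x \<Longrightarrow> g v k = f v k" "x < j"
  shows "column_list g k j = column_list f k j @ [(x, k)]"
  using assms(4)
proof (induction j)
  case (Suc j)
  show ?case
  proof (cases "j = x")
    case True
    then have "column_list f k j = []" "column_list g k j = []"
      using assms by (auto intro!: column_list_eq_Nil)
    then show ?thesis using True assms(2)
      by (simp add: column_list_Suc replicate_append_same)
  qed (use Suc assms(3) in \<open>simp add: column_list_Suc\<close>)
qed simp

text \<open>Insertion order is reading order: rows never increase within a column, and a new column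
  opens on the diagonal once the previous one is complete.\<close>

lemma reduced_eq_matrix_list:
  assumes "reduced e xs"
  shows "xs = matrix_list (\<lambda>i j. count (mset xs) (i, j)) (Suc e)"
  using assms
proof induction
  case start
  show ?case by (simp add: matrix_list_def column_list_def)
next
  case (weak e xs x)
  let ?f = "\<lambda>i j. count (mset xs) (i, j)" and ?g = "\<lambda>i j. count (mset (xs @ [(x, e)])) (i, j)"
  have b: "builds (map fst xs) e xs" and ne: "xs \<noteq> []" using reduced_builds[OF weak.hyps(1)] by auto
  have "x \<le> e" using weak.hyps(2) builds_rep[OF b] ne by (simp add: last_map)
  moreover have "count (mset xs) (v, e) = 0" if "v < x" for v
    using that weak.hyps(2) builds_set(5)[OF b, of v] ne
    by (force simp: last_map count_eq_zero_iff)
  ultimately have "column_list ?g e (Suc e) = column_list ?f e (Suc e) @ [(x, e)]"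
    by (intro column_list_snoc) auto
  moreover have "matrix_list ?g e = matrix_list ?f e" by (intro matrix_list_cong) auto
  ultimately have "matrix_list ?g (Suc e) = matrix_list ?f (Suc e) @ [(x, e)]"
    by (simp add: matrix_list_Suc)
  then show ?case using weak.IH by simp
next
  case (top e xs)
  let ?f = "\<lambda>i j. count (mset xs) (i, j)"
    and ?g = "\<lambda>i j. count (mset (xs @ [(Suc e, Suc e)])) (i, j)"
  have b: "builds (map fst xs) e xs" using reduced_builds[OF top.hyps(1)] by auto
  have zero: "?f v (Suc e) = 0" for v
    using builds_snd_le[OF b, of "(v, Suc e)"] by (auto simp: count_eq_zero_iff)
  have "column_list ?f (Suc e) (Suc (Suc e)) = []" using zero by (intro column_list_eq_Nil) auto
  moreover have "column_list ?g (Suc e) (Suc (Suc e)) =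
      column_list ?f (Suc e) (Suc (Suc e)) @ [(Suc e, Suc e)]"
    using zero by (intro column_list_snoc) auto
  moreover have "matrix_list ?g (Suc e) = matrix_list ?f (Suc e)" by (intro matrix_list_cong) auto
  ultimately have "matrix_list ?g (Suc (Suc e)) = matrix_list ?f (Suc e) @ [(Suc e, Suc e)]"
    by (simp add: matrix_list_Suc[of _ "Suc e"])
  then show ?case using top.IH by simp
qed

text \<open>Every column is opened by its diagonal element. This property survives
  reflection.\<close>

lemma reduced_diag: "reduced e xs \<Longrightarrow> i \<le> e \<Longrightarrow> (i, i) \<in> set xs"
  by (induction rule: reduced.induct) (auto simp: le_Suc_eq)

lemma reduced_append:
  assumes "reduced e xs" "sorted_wrt (\<ge>) (fst (last xs) # map fst ys)" "\<forall>p \<in> set ys. snd p = e"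
  shows "reduced e (xs @ ys)"
  using assms
proof (induction ys arbitrary: xs)
  case (Cons y ys)
  have "reduced e (xs @ [(fst y, e)])" by (rule reduced.weak) (use Cons.prems in auto)
  moreover have "(fst y, e) = y" using Cons.prems(3) by auto
  ultimately have "reduced e (xs @ [y])" by simp
  then have "reduced e ((xs @ [y]) @ ys)" by (rule Cons.IH) (use Cons.prems in auto)
  then show ?case by simp
qed simp

lemma set_column_list: "p \<in> set (column_list f k j) \<Longrightarrow> fst p < j \<and> snd p = k"
  by (auto simp: column_list_def)

lemma sorted_column_list: "sorted_wrt (\<ge>) (map fst (column_list f k j))"
proof (induction j)
  case (Suc j)
  then show ?case
    by (auto simp: column_list_Suc sorted_wrt_append dest!: set_column_list)
      (simp add: sorted_wrt_iff_nth_less)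
qed simp

lemma column_list_hd:
  assumes "0 < f k k"
  shows "\<exists>ys. column_list f k (Suc k) = (k, k) # ys \<and> sorted_wrt (\<ge>) (k # map fst ys) \<and>
    (\<forall>p \<in> set ys. snd p = k)"
proof -
  obtain n where "f k k = Suc n" using assms gr0_implies_Suc by blast
  then have eq: "column_list f k (Suc k) = (k, k) # (replicate n (k, k) @ column_list f k k)"
    by (simp add: column_list_Suc)
  show ?thesis
    using sorted_column_list[of f k "Suc k"] set_column_list[of _ f k "Suc k"] unfolding eq
    by (intro exI[of _ "replicate n (k, k) @ column_list f k k"]) auto
qed

text \<open>Converse direction: a positive diagonal entry supplies the (AP2) step that opens a
  column, and the rest of the column is a run of (AP1) steps.\<close>

lemma reduced_matrix_list:
  assumes "\<And>i. i \<le> e \<Longrightarrow> 0 < f i i"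
  shows "reduced e (matrix_list f (Suc e))"
  using assms
proof (induction e)
  case 0
  obtain ys where "column_list f 0 (Suc 0) = (0, 0) # ys" "sorted_wrt (\<ge>) (0 # map fst ys)"
    "\<forall>p \<in> set ys. snd p = 0"
    using column_list_hd[of f 0] 0 by auto
  then show ?case using reduced_append[OF reduced.start, of ys] by (simp add: matrix_list_def)
next
  case (Suc e)
  obtain ys where ys: "column_list f (Suc e) (Suc (Suc e)) = (Suc e, Suc e) # ys"
    "sorted_wrt (\<ge>) (Suc e # map fst ys)" "\<forall>p \<in> set ys. snd p = Suc e"
    using column_list_hd[of f "Suc e"] Suc.prems by auto
  have "reduced e (matrix_list f (Suc e))" using Suc by simp
  then have "reduced (Suc e) (matrix_list f (Suc e) @ [(Suc e, Suc e)])" by (rule reduced.top)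
  then have "reduced (Suc e) ((matrix_list f (Suc e) @ [(Suc e, Suc e)]) @ ys)"
    by (rule reduced_append) (use ys in auto)
  then show ?case using ys(1) by (simp add: matrix_list_Suc[of _ "Suc e"])
qed

lemma count_column_list:
  "count (mset (column_list f k j)) (i, l) = (if l = k \<and> i < j then f i k else 0)"
  by (induction j) (auto simp: column_list_Suc less_Suc_eq)

lemma count_matrix_list:
  "count (mset (matrix_list f d)) (i, j) = (if i \<le> j \<and> j < d then f i j else 0)"
proof (induction d)
  case (Suc d)
  then show ?case by (auto simp: matrix_list_Suc count_column_list less_Suc_eq)
qed (simp add: matrix_list_def)

lemma map_fst_matrix_list:
  "map fst (matrix_list f d) =
    concat (map (\<lambda>k. concat (map (\<lambda>v. replicate (f v k) v) (rev [0..<Suc k]))) [0..<d])"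
  by (simp add: matrix_list_def column_list_def map_concat o_def)

section \<open>Duality\<close>

lemma image_mset_nth: "image_mset (nth xs) (mset_set {0..<length xs}) = mset xs"
  by (metis map_nth mset_map mset_upt)

text \<open>For uniqueness, any competing ascent sequence builds a list whose multiset is an
  isomorphism invariant, and \<open>builds_inj\<close> applies.\<close>

lemma f_PA_eqI:
  assumes xs: "builds b e xs" and P: "interval_rep P e' v" "fst P = {0..<length xs}"
    and eq: "image_mset v (mset_set (fst P)) = mset xs"
  shows "f_PA P = b"
  unfolding f_PA_def
proof (rule the_equality)
  note rep = builds_rep[OF xs]
  have "poset_iso (f_AP b) P"
    by (rule poset_iso_if_mset_eq[of _ e "nth xs" _ e' v])
      (use rep P eq image_mset_nth[of xs] in auto)
  then show "ascent_seq b \<and> poset_iso (f_AP b) P" using rep by blast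
  fix b' assume b': "ascent_seq b' \<and> poset_iso (f_AP b') P"
  then obtain xs' where xs': "builds b' (asc b') xs'" using builds_exists by blast
  note rep' = builds_rep[OF xs']
  have "mset xs' = mset xs"
    using interval_rep_iso(2)[of "f_AP b'" "asc b'" "nth xs'" P e' v] rep' P(1) b' eq
      image_mset_nth[of xs'] by simp
  then show "b' = b" by (rule builds_inj[OF xs' xs])
qed

text \<open>The reflected multiset again contains the diagonal, so \<open>?ys\<close> arises from a
  sequence in reduced form; the dual poset has the same intervals, up to labelling.\<close>

lemma dual_asc_reduced:
  assumes xs: "reduced e xs"
  shows "dual_asc (map fst xs) =
    map fst (matrix_list (\<lambda>i j. count (mset xs) (e - j, e - i)) (Suc e))"
proof -
  let ?f = "\<lambda>i j. count (mset xs) (e - j, e - i)"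
  let ?ys = "matrix_list ?f (Suc e)"
  let ?flip = "\<lambda>p :: nat \<times> nat. (e - snd p, e - fst p)"
  have b: "builds (map fst xs) e xs" using reduced_builds[OF xs] by blast
  note rep = builds_rep[OF b]
  have "reduced e ?ys"
    by (rule reduced_matrix_list) (use reduced_diag[OF xs] in simp)
  then have ys: "builds (map fst ?ys) e ?ys" using reduced_builds by blast
  have flip: "image_mset ?flip (mset xs) = mset ?ys"
  proof (rule multiset_eqI)
    fix p :: "nat \<times> nat"
    obtain i j where p: "p = (i, j)" by (cases p)
    \<comment> \<open>The bounds on \<open>i\<close> and \<open>j\<close> exclude spurious preimages
      created by truncated subtraction.\<close>
    have "?flip y = (i, j) \<longleftrightarrow> y = (e - j, e - i) \<and> i \<le> j \<and> j \<le> e" if "y \<in> set xs" for y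
      using builds_set(3)[OF b that] builds_snd_le[OF b that] by (cases y) auto
    then have "?flip -` {p} \<inter> set_mset (mset xs) =
        (if i \<le> j \<and> j < Suc e then {(e - j, e - i)} \<inter> set xs else {})"
      unfolding p by (auto simp: less_Suc_eq_le)
    moreover have "sum (count (mset xs)) ({z} \<inter> set xs) = count (mset xs) z" for z
      by (cases "z \<in> set xs") (auto simp: count_eq_zero_iff)
    ultimately show "count (image_mset ?flip (mset xs)) p = count (mset ?ys) p"
      unfolding count_image_mset p count_matrix_list by auto
  qed
  have "size (image_mset ?flip (mset xs)) = size (mset ?ys)" by (simp only: flip)
  then have len: "length xs = length ?ys" by (simp only: size_image_mset size_mset)
  show ?thesis unfolding dual_asc_def
  proof (rule f_PA_eqI[OF ys])
    show "interval_rep (dual_poset (f_AP (map fst xs))) e (\<lambda>p. ?flip (xs ! p))"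
      by (rule rep_dual[of _ e "nth xs"]) (use rep in blast)
    show car: "fst (dual_poset (f_AP (map fst xs))) = {0..<length ?ys}"
      unfolding len[symmetric] using rep by (simp add: dual_poset_def)
    have "image_mset (\<lambda>p. ?flip (xs ! p)) (mset_set {0..<length xs}) = image_mset ?flip (mset xs)"
      unfolding image_mset_nth[of xs, symmetric] by (simp add: image_mset.compositionality o_def)
    then show "image_mset (\<lambda>p. ?flip (xs ! p)) (mset_set (fst (dual_poset (f_AP (map fst xs))))) = mset ?ys"
      unfolding car len[symmetric] flip .
  qed
qed

theorem theorem4p3:
  fixes n d :: nat and a :: "nat list" and M :: "nat mat" and m :: "nat \<Rightarrow> nat \<Rightarrow> nat"
  assumes "a \<in> RAsc n"
    and "M = f_AM a"
    and "dim_row M = d"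
    and "\<And>i j. m i j = M $$ (i - 1, j - 1)"
  shows "a = concat (map (\<lambda>k. concat (map (\<lambda>v. replicate (m (v + 1) k) v) (rev [0..<k])))
                         [1..<d + 1])
       \<and> dual_asc a =
           concat (map (\<lambda>k. concat (map (\<lambda>v. replicate (m (d + 1 - k) (d - v)) v) (rev [0..<k])))
                       [1..<d + 1])"
proof -
  obtain e xs where xs: "reduced e xs" "map fst xs = a" using reduced_exists[OF assms(1)] by blast
  let ?c = "\<lambda>i j. count (mset xs) (i, j)"
  have M: "M = mat (Suc e) (Suc e) (\<lambda>(i, j). ?c i j)" using f_AM_reduced[OF xs(1)] xs(2) assms(2) by simp
  then have d: "d = Suc e" using assms(3) by simp
  \<comment> \<open>\<open>m\<close> is indexed from 1, the multiplicities from 0.\<close>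
  have m: "m (Suc i) (Suc j) = ?c i j" if "i < d" "j < d" for i j
    using that by (simp add: assms(4) M d)
  have shift: "[1..<d + 1] = map Suc [0..<d]" by (simp add: map_Suc_upt)
  have "a = map fst (matrix_list ?c d)"
    using reduced_eq_matrix_list[OF xs(1)] xs(2) d by metis
  also have "matrix_list ?c d = matrix_list (\<lambda>v k. m (v + 1) (Suc k)) d"
    by (rule matrix_list_cong) (simp add: m)
  finally have 1: "a = map fst (matrix_list (\<lambda>v k. m (v + 1) (Suc k)) d)" .
  have "dual_asc a = map fst (matrix_list (\<lambda>v k. ?c (e - k) (e - v)) d)"
    using dual_asc_reduced[OF xs(1)] xs(2) d by simp
  \<comment> \<open>With \<open>d = Suc e\<close>, \<open>d + 1 - Suc k\<close> and
    \<open>d - v\<close> are the successors of \<open>e - k\<close> and \<open>e - v\<close>, as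
    \<open>v \<le> k < d\<close>.\<close>
  also have "matrix_list (\<lambda>v k. ?c (e - k) (e - v)) d =
      matrix_list (\<lambda>v k. m (d + 1 - Suc k) (d - v)) d"
    by (rule matrix_list_cong) (simp add: m[symmetric] d Suc_diff_le)
  finally have 2: "dual_asc a = map fst (matrix_list (\<lambda>v k. m (d + 1 - Suc k) (d - v)) d)" .
  show ?thesis
    unfolding shift map_map o_def using 1 2 by (simp only: map_fst_matrix_list)
qed

end
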